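(* Let $z=qe^{i\omega}$ with $q>0$ and $\omega=\frac{d}{p}2\pi\in(0,\pi)$ for some positive integers $d,p$. If $\varphi<|z|\le q(p)$, where $\varphi=\frac{1+\sqrt5}2$, then $R_\infty(z)$ is a polygon in the complex plane containing the origin.
   Context: $(f_n)_{n\ge 0}$ is the Fibonacci sequence with $f_0=f_1=1$ and $f_{n+2}=f_{n+1}+f_n$. For $z\in\mathbb C$ with $|z|>\varphi$, $$R_\infty(z)=\left\{\sum_{k=0}^\infty u_k\frac{f_k}{z^k}\;\middle|\;u_k\in\{0,1\}\text{ for all }k\ge 0\right\}\subset\mathbb C .$$ For a positive integer $p$, $q(p)$ denotes the greatest real solution $q$ of the equation $\sum_{k=0}^\infty\frac{f_{pk}}{q^{pk}}=2$. A polygon is understood as a filled polygonal region of the plane (the boundary together with its interior). *)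

theory Defs
  imports "HOL-Analysis.Analysis" "HOL-Number_Theory.Fib"
begin

text \<open>Fibonacci numbers indexed so that the sequence starts \<open>1, 1, 2, 3, \<dots>\<close>, whereas the
  library function \<^const>\<open>fib\<close> starts \<open>0, 1, 1, 2, \<dots>\<close>.\<close>

definition fib1 :: "nat \<Rightarrow> nat" where
  "fib1 n = fib (Suc n)"

lemma fib1_rec: "fib1 0 = 1" "fib1 1 = 1" "fib1 (n + 2) = fib1 (n + 1) + fib1 n"
  by (simp_all add: fib1_def)

definition golden_ratio :: real where
  "golden_ratio = (1 + sqrt 5) / 2"

definition R_inf :: "complex \<Rightarrow> complex set" where
  "R_inf z = {x. \<exists>u :: nat \<Rightarrow> complex. (\<forall>k. u k \<in> {0, 1}) \<and>
                 (\<lambda>k. u k * (of_nat (fib1 k) / z ^ k)) sums x}"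

text \<open>For \<open>p > 0\<close> the greatest solution exists: the series diverges for \<open>0 < q \<le> golden_ratio\<close>,
  and on \<open>q > golden_ratio\<close> its sum decreases strictly and continuously from infinity to \<open>1\<close>.
  The predicate \<^const>\<open>sums\<close> includes convergence, so no divergent series counts as a solution.\<close>

definition q_crit :: "nat \<Rightarrow> real" where
  "q_crit p = (GREATEST q :: real. (\<lambda>k. real (fib1 (p * k)) / q ^ (p * k)) sums 2)"

definition polygon_edge :: "complex list \<Rightarrow> nat \<Rightarrow> complex set" where
  "polygon_edge vs i = closed_segment (vs ! i) (vs ! (Suc i mod length vs))"

definition polygon_boundary :: "complex list \<Rightarrow> complex set" where
  "polygon_boundary vs = (\<Union>i<length vs. polygon_edge vs i)"

text \<open>A simple closed polygonal curve: two different edges meet exactly in the end points they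
  share. This makes non-adjacent edges disjoint and excludes degenerate (flat) polygons.\<close>

definition simple_polygon_vertices :: "complex list \<Rightarrow> bool" where
  "simple_polygon_vertices vs \<longleftrightarrow> 3 \<le> length vs \<and> distinct vs \<and>
     (\<forall>i<length vs. \<forall>j<length vs. i \<noteq> j \<longrightarrow>
        polygon_edge vs i \<inter> polygon_edge vs j =
          {vs ! i, vs ! (Suc i mod length vs)} \<inter> {vs ! j, vs ! (Suc j mod length vs)})"

definition is_polygon :: "complex set \<Rightarrow> bool" where
  "is_polygon S \<longleftrightarrow> (\<exists>vs. simple_polygon_vertices vs \<and>
     S = polygon_boundary vs \<union> inside (polygon_boundary vs))"

end

theory Submission
  imports Defs
begin

text \<open>
  Since \<open>p \<omega>\<close> is a multiple of \<open>2 \<pi>\<close>, the argument \<open>- k \<omega>\<close> of the \<open>k\<close>-th term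
  \<open>f\<^sub>k / z\<^sup>k\<close> depends only on \<open>r = k mod p\<close>. Splitting the series into residue classes
  therefore writes \<^term>\<open>R_inf z\<close> as the Minkowski sum of \<open>p\<close> sets, each lying on a ray
  from the origin: the set of all subsums of the positive series
  \<open>\<Sum>\<^sub>j f\<^bsub>pj+r\<^esub> / q\<^bsup>pj+r\<^esup>\<close>, turned by the angle \<open>- r \<omega>\<close>.

  By Kakeya's theorem such a set of subsums is a whole interval as soon as no term exceeds the sum
  of the terms after it (\<open>subsums_fill_interval\<close>). Here this reads
  \<open>f\<^sub>m \<le> \<Sum>\<^bsub>k\<ge>1\<^esub> f\<^bsub>m+pk\<^esub> / q\<^bsup>pk\<^esup>\<close>. For \<open>m = 0\<close> it is exactly the condition
  \<open>q \<le> q(p)\<close>, because the series in the definition of \<open>q(p)\<close> decreases in \<open>q\<close>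
  (\<open>fib1_multiples_series_ge_2\<close>); for other \<open>m\<close> it follows from the case \<open>m = 0\<close>
  because \<open>f\<^sub>m f\<^sub>n \<le> f\<^bsub>m+n\<^esub>\<close> (\<open>fib1_term_le_tail\<close>). Hence
  \<^term>\<open>R_inf z\<close> is a finite Minkowski sum of segments issuing from the origin
  (\<open>subsums_with_periodic_directions\<close>).

  It remains to see that such a sum is a polygon unless all segments are parallel
  (\<open>sum_of_segments_is_polygon\<close>). Reversing a segment only translates the sum, and parallel
  segments can be merged, so the directions may be taken distinct, with angles in \<open>[0, \<pi>)\<close>, and
  sorted by angle. Placing the segments one after another in this order, and then their reverses
  in the same order, traces a closed convex curve; this curve is the frontier of the sum
  (locale \<open>zonogon\<close>). The first two of the directions above are not parallel since
  \<open>0 < \<omega> < \<pi>\<close>.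
\<close>

section \<open>Zonogons\<close>

text \<open>The signed area of the parallelogram spanned by \<open>a\<close> and \<open>b\<close>: it is positive iff \<open>b\<close>
  points to the left of \<open>a\<close>.\<close>

definition wedge :: "complex \<Rightarrow> complex \<Rightarrow> real" where
  "wedge a b = Re a * Im b - Im a * Re b"

lemma wedge_simps [simp]:
  "wedge a (b + c) = wedge a b + wedge a c"
  "wedge (b + c) a = wedge b a + wedge c a"
  "wedge a (b - c) = wedge a b - wedge a c"
  "wedge a (- b) = - wedge a b"
  "wedge (- b) a = - wedge b a"
  "wedge a (r *\<^sub>R b) = r * wedge a b"
  "wedge (r *\<^sub>R b) a = r * wedge b a"
  "wedge a a = 0" "wedge a 0 = 0" "wedge 0 a = 0"
  by (simp_all add: wedge_def algebra_simps)

lemma wedge_sum: "wedge a (\<Sum>i\<in>I. f i) = (\<Sum>i\<in>I. wedge a (f i))"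
  by (induction I rule: infinite_finite_induct) simp_all

text \<open>Cramer's rule in the plane.\<close>

lemma wedge_expand: "wedge a b *\<^sub>R v = wedge v b *\<^sub>R a + wedge a v *\<^sub>R b"
  by (simp add: complex_eq_iff wedge_def algebra_simps)

lemma inner_zero_if_wedge:
  assumes "wedge u v \<noteq> 0" "a \<bullet> u = 0" "a \<bullet> v = 0"
  shows "a = 0"
proof -
  have "wedge u v *\<^sub>R a = wedge a v *\<^sub>R u + wedge u a *\<^sub>R v"
    by (rule wedge_expand)
  then have "a \<bullet> (wedge u v *\<^sub>R a) = 0"
    using assms by (simp only: inner_add_right inner_scaleR_right)
  then show ?thesis using assms by simp
qed

text \<open>A convex set with empty interior lies in a hyperplane, whose normal vector then serves; otherwise
  the interior is the relative interior and the supporting hyperplane theorem applies.\<close>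

lemma supporting_functional_at_boundary_point:
  fixes S :: "'a::euclidean_space set"
  assumes "convex S" "x \<in> S" "x \<notin> interior S"
  obtains a where "a \<noteq> 0" "\<And>y. y \<in> S \<Longrightarrow> a \<bullet> x \<le> a \<bullet> y"
proof (cases "interior S = {}")
  case True
  obtain a b where "a \<noteq> 0" "S \<subseteq> {x. a \<bullet> x = b}"
    using empty_interior_subset_hyperplane[OF assms(1) True] by metis
  then have "a \<bullet> y = b" if "y \<in> S" for y using that by blast
  with assms(2) \<open>a \<noteq> 0\<close> that[of a] show ?thesis by simp
next
  case False
  then have "x \<notin> rel_interior S"
    using assms(3) by (simp add: rel_interior_nonempty_interior)
  with supporting_hyperplane_rel_boundary[OF assms(1,2)] that show ?thesis by metis
qed

text \<open>
  The edge vectors of a centrally symmetric convex \<open>2n\<close>-gon, read counterclockwise and continued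
  periodically. Opposite edges are traversed in opposite directions, whence antiperiodicity; the
  second condition says that the edges turn to the left, by less than a half turn over fewer
  than \<open>n\<close> steps. Indexing by all natural numbers makes every edge look the same, so that no
  argument has to treat the two halves of the boundary separately.
\<close>

locale zonogon =
  fixes n :: nat and w :: "nat \<Rightarrow> complex" and c :: complex
  assumes two_directions: "2 \<le> n"
    and antiperiodic: "w (j + n) = - w j"
    and left_turn: "i < j \<Longrightarrow> j < i + n \<Longrightarrow> 0 < wedge (w i) (w j)"
begin

definition vertex :: "nat \<Rightarrow> complex" where
  "vertex m = c + (\<Sum>l<m. w l)"

definition region :: "complex set" where
  "region = {c} + (\<Sum>l<n. closed_segment 0 (w l))"

lemma vertex_Suc: "vertex (Suc m) = vertex m + w m"
  by (simp add: vertex_def)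

lemma vertex_add:
  "vertex (i + k) = vertex i + (\<Sum>l\<in>{i..<i + k}. w l)"
  by (induction k) (simp_all add: vertex_Suc)

lemma vertex_periodic: "vertex (m + 2 * n) = vertex m"
proof -
  have "vertex (m + n + n) = vertex (m + n) + (\<Sum>l\<in>{m + n..<m + n + n}. w l)"
    by (rule vertex_add)
  also have "(\<Sum>l\<in>{m + n..<m + n + n}. w l) = (\<Sum>l\<in>{m..<m + n}. w (l + n))"
    by (rule sum.shift_bounds_nat_ivl)
  also have "\<dots> = - (\<Sum>l\<in>{m..<m + n}. w l)"
    by (simp add: antiperiodic sum_negf)
  finally show ?thesis
    by (simp add: vertex_add mult_2 add.assoc)
qed

lemma vertex_mod: "vertex (m mod (2 * n)) = vertex m"
proof -
  have "vertex (m + k * (2 * n)) = vertex m" for m k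
  proof (induction k)
    case (Suc k)
    have "vertex (m + Suc k * (2 * n)) = vertex (m + k * (2 * n) + 2 * n)"
      by (simp add: algebra_simps)
    then show ?case by (simp only: vertex_periodic Suc)
  qed simp
  from this[of "m mod (2 * n)" "m div (2 * n)"] show ?thesis
    by (simp only: mod_div_mult_eq)
qed

text \<open>Every vertex can play the role of the starting point: passing from vertex \<open>m\<close> to the next one
  replaces the segment along \<open>w m\<close> by its reverse, and \<open>w (m + n)\<close> is \<open>- w m\<close>.
  This symmetry carries the rest of the argument.\<close>

lemma region_based_at_vertex:
  "region = {vertex m} + (\<Sum>l\<in>{m..<m + n}. closed_segment 0 (w l))"
proof (induction m)
  case 0
  show ?case by (simp add: region_def vertex_def lessThan_atLeast0)
next
  case (Suc m)
  let ?R = "\<Sum>l\<in>{Suc m..<m + n}. closed_segment 0 (w l)"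
  have flip: "{v} + closed_segment 0 u = {v + u} + closed_segment 0 (- u)" for u v :: complex
  proof -
    have "{v} + closed_segment 0 u = closed_segment v (v + u)"
      using closed_segment_translation[of v 0 u] by (auto simp: set_plus_def)
    moreover have "{v + u} + closed_segment 0 (- u) = closed_segment (v + u) v"
      using closed_segment_translation[of "v + u" 0 "- u"] by (auto simp: set_plus_def)
    ultimately show ?thesis by (simp add: closed_segment_commute)
  qed
  have "region = {vertex m} + (closed_segment 0 (w m) + ?R)"
    using Suc two_directions by (simp add: sum.atLeast_Suc_lessThan)
  also have "\<dots> = ({vertex m} + closed_segment 0 (w m)) + ?R"
    by (simp add: add.assoc)
  also have "\<dots> = ({vertex (Suc m)} + closed_segment 0 (w (m + n))) + ?R"
    by (simp add: flip[of "vertex m" "w m"] vertex_Suc antiperiodic)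
  also have "\<dots> = {vertex (Suc m)} + (?R + closed_segment 0 (w (m + n)))"
    by (simp only: ac_simps)
  also have "?R + closed_segment 0 (w (m + n)) = (\<Sum>l\<in>{Suc m..<Suc m + n}. closed_segment 0 (w l))"
    using two_directions by simp
  finally show ?case .
qed

lemma mem_region_iff:
  "x \<in> region \<longleftrightarrow> (\<exists>\<tau>. (\<forall>l. 0 \<le> \<tau> l \<and> \<tau> l \<le> 1) \<and> x = vertex m + (\<Sum>l\<in>{m..<m + n}. \<tau> l *\<^sub>R w l))"
proof
  assume "x \<in> region"
  then obtain s where s: "\<And>l. l \<in> {m..<m + n} \<Longrightarrow> s l \<in> closed_segment 0 (w l)"
      and x: "x = vertex m + (\<Sum>l\<in>{m..<m + n}. s l)"
    unfolding region_based_at_vertex[of m] set_sum_alt[OF finite_atLeastLessThan] set_plus_def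
    by blast
  have "\<forall>l. \<exists>t. 0 \<le> t \<and> t \<le> 1 \<and> (l \<in> {m..<m + n} \<longrightarrow> s l = t *\<^sub>R w l)"
  proof
    fix l
    show "\<exists>t. 0 \<le> t \<and> t \<le> 1 \<and> (l \<in> {m..<m + n} \<longrightarrow> s l = t *\<^sub>R w l)"
    proof (cases "l \<in> {m..<m + n}")
      case True
      then show ?thesis using s[OF True] by (auto simp: closed_segment_def)
    next
      case False
      then show ?thesis by (intro exI[of _ 0]) auto
    qed
  qed
  then obtain \<tau> where t: "\<And>l. 0 \<le> \<tau> l \<and> \<tau> l \<le> 1 \<and> (l \<in> {m..<m + n} \<longrightarrow> s l = \<tau> l *\<^sub>R w l)"
    by metis
  have "(\<Sum>l\<in>{m..<m + n}. s l) = (\<Sum>l\<in>{m..<m + n}. \<tau> l *\<^sub>R w l)"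
    by (rule sum.cong) (use t in auto)
  with t x show "\<exists>\<tau>. (\<forall>l. 0 \<le> \<tau> l \<and> \<tau> l \<le> 1) \<and> x = vertex m + (\<Sum>l\<in>{m..<m + n}. \<tau> l *\<^sub>R w l)"
    by metis
next
  assume "\<exists>\<tau>. (\<forall>l. 0 \<le> \<tau> l \<and> \<tau> l \<le> 1) \<and> x = vertex m + (\<Sum>l\<in>{m..<m + n}. \<tau> l *\<^sub>R w l)"
  then obtain \<tau> where t: "\<And>l. 0 \<le> \<tau> l \<and> \<tau> l \<le> 1"
    and x: "x = vertex m + (\<Sum>l\<in>{m..<m + n}. \<tau> l *\<^sub>R w l)" by auto
  have "(\<Sum>l\<in>{m..<m + n}. \<tau> l *\<^sub>R w l) \<in> (\<Sum>l\<in>{m..<m + n}. closed_segment 0 (w l))"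
    unfolding set_sum_alt[OF finite_atLeastLessThan]
    using t by (auto simp: closed_segment_def intro!: exI[of _ "\<lambda>l. \<tau> l *\<^sub>R w l"])
  then show "x \<in> region"
    by (auto simp: region_based_at_vertex[of m] x set_plus_def)
qed

lemma convex_region: "convex region"
  unfolding region_def by (intro convex_set_plus convex_set_sum) auto

lemma compact_region: "compact region"
proof -
  have plus: "compact (A + B)" if "compact A" "compact B" for A B :: "complex set"
  proof -
    have "A + B = (\<Union>x\<in>A. \<Union>y\<in>B. {x + y})" by (auto simp: set_plus_def)
    then show ?thesis using compact_sums'[OF that] by simp
  qed
  have "compact (\<Sum>l\<in>I. closed_segment 0 (w l))" if "finite I" for I
    using that by induction (auto intro!: plus)
  then show ?thesis unfolding region_def by (intro plus) auto
qed

definition side :: "nat \<Rightarrow> complex set" where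
  "side m = closed_segment (vertex m) (vertex (Suc m))"

lemma mem_side_iff: "x \<in> side m \<longleftrightarrow> (\<exists>t. 0 \<le> t \<and> t \<le> 1 \<and> x = vertex m + t *\<^sub>R w m)"
  by (auto simp: side_def vertex_Suc closed_segment_def algebra_simps)

text \<open>The region lies to the left of each of its sides: seen from vertex \<open>i\<close> it is spanned by
  \<open>w i, \<dots>, w (i + n - 1)\<close>, none of which points to the right of \<open>w i\<close>.\<close>

lemma wedge_side_region_nonneg:
  assumes "x \<in> region"
  shows "0 \<le> wedge (w i) (x - vertex i)"
proof -
  obtain \<tau> where t: "\<And>l. 0 \<le> \<tau> l \<and> \<tau> l \<le> 1"
    and x: "x = vertex i + (\<Sum>l\<in>{i..<i + n}. \<tau> l *\<^sub>R w l)"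
    using assms unfolding mem_region_iff[of x i] by auto
  have "0 \<le> \<tau> l * wedge (w i) (w l)" if "l \<in> {i..<i + n}" for l
    using t[of l] left_turn[of i l] that by (cases "l = i") auto
  then show ?thesis
    unfolding x by (auto simp: wedge_sum intro!: sum_nonneg)
qed

lemma side_subset_region: "side m \<subseteq> region"
proof
  fix x assume "x \<in> side m"
  then obtain t where "0 \<le> t" "t \<le> 1" "x = vertex m + t *\<^sub>R w m"
    by (auto simp: mem_side_iff)
  moreover have "(\<Sum>l\<in>{m..<m + n}. (if l = m then t else 0) *\<^sub>R w l) = t *\<^sub>R w m"
    using two_directions by (simp add: if_distrib[of "\<lambda>r. r *\<^sub>R _"] sum.delta cong: if_cong)
  ultimately show "x \<in> region"
    unfolding mem_region_iff[of x m] by (intro exI[of _ "\<lambda>l. if l = m then t else 0"]) auto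
qed

lemma direction_nonzero: "w i \<noteq> 0"
  using left_turn[of i "Suc i"] two_directions by auto

lemma side_subset_frontier: "side m \<subseteq> frontier region"
proof
  fix x assume x: "x \<in> side m"
  have "x \<notin> interior region"
  proof
    assume "x \<in> interior region"
    then obtain e where e: "e > 0" "ball x e \<subseteq> region"
      using mem_interior by blast
    \<comment> \<open>A small step to the right of the side leaves the region.\<close>
    define y where "y = x - (e / (2 * cmod (w m))) *\<^sub>R (\<i> * w m)"
    have "dist x y = e / 2"
      using e(1) direction_nonzero[of m] by (simp add: y_def dist_norm norm_mult)
    then have "y \<in> region" using e by auto
    then have "0 \<le> wedge (w m) (y - vertex m)" by (rule wedge_side_region_nonneg)
    moreover have "wedge (w m) (x - vertex m) = 0"
      using x by (auto simp: mem_side_iff)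
    ultimately have "(e / (2 * cmod (w m))) * wedge (w m) (\<i> * w m) \<le> 0"
      by (simp add: y_def)
    moreover have "wedge (w m) (\<i> * w m) > 0"
      using direction_nonzero[of m] by (simp add: wedge_def complex_eq_iff sum_squares_gt_zero_iff)
    ultimately show False
      using e(1) direction_nonzero[of m] by (simp add: mult_le_0_iff divide_le_0_iff)
  qed
  then show "x \<in> frontier region"
    using x side_subset_region compact_region by (auto simp: frontier_def compact_imp_closed)
qed

text \<open>A linear functional changes sign along the boundary, by antiperiodicity; the vertex between the
  two edges found here minimises the functional on the region.\<close>

lemma sign_change:
  assumes "a \<noteq> 0"
  obtains m where "a \<bullet> w m < 0" "0 \<le> a \<bullet> w (Suc m)"
proof -
  have "wedge (w 0) (w 1) > 0" using left_turn[of 0 1] two_directions by simp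
  then obtain j where "a \<bullet> w j \<noteq> 0"
    using inner_zero_if_wedge[of "w 0" "w 1" a] assms by auto
  then have "a \<bullet> w j < 0 \<or> a \<bullet> w (j + n) < 0"
    using antiperiodic[of j] by auto
  then obtain i where i: "a \<bullet> w i < 0" by blast
  define k where "k = (LEAST k. 0 \<le> a \<bullet> w (i + k))"
  have ex: "0 \<le> a \<bullet> w (i + n)" using i by (simp add: antiperiodic)
  have k: "0 \<le> a \<bullet> w (i + k)" unfolding k_def by (rule LeastI) (rule ex)
  have "k \<noteq> 0" using i k by (cases k) auto
  then obtain k' where k': "k = Suc k'" by (cases k) auto
  have "\<not> 0 \<le> a \<bullet> w (i + k')"
    using k' not_less_Least[of k' "\<lambda>k. 0 \<le> a \<bullet> w (i + k)"] by (simp add: k_def)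
  with k k' that[of "i + k'"] show ?thesis by simp
qed

text \<open>At a frontier point some functional \<open>a\<close> attains its minimum. Based at the minimising vertex
  \<open>m + 1\<close>, the region is spanned by \<open>w (m + 1), \<dots>, w (m + n)\<close>, all of which but the first have a
  positive value under \<open>a\<close>. A minimiser cannot use these, so it lies on side \<open>m + 1\<close>.\<close>

lemma frontier_subset_sides: "frontier region \<subseteq> (\<Union>m. side m)"
proof
  fix x assume "x \<in> frontier region"
  then have xin: "x \<in> region" and "x \<notin> interior region"
    using compact_region by (auto simp: frontier_def compact_imp_closed)
  then obtain a where a: "a \<noteq> 0" and min: "\<And>y. y \<in> region \<Longrightarrow> a \<bullet> x \<le> a \<bullet> y"
    using supporting_functional_at_boundary_point[OF convex_region] by metis
  obtain m where m: "a \<bullet> w m < 0" "0 \<le> a \<bullet> w (Suc m)"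
    using sign_change[OF a] .
  \<comment> \<open>The vectors strictly between \<open>w (m + 1)\<close> and \<open>w (m + n) = - w m\<close> are positive
    combinations of these two.\<close>
  have pos: "0 < a \<bullet> w l" if "Suc m < l" "l \<le> m + n" for l
  proof (cases "l = m + n")
    case True
    then show ?thesis using m by (simp add: antiperiodic)
  next
    case False
    have w: "0 < wedge (w m) (w l)" "0 < wedge (w (Suc m)) (w l)"
      using left_turn[of m l] left_turn[of "Suc m" l] that False by auto
    have "wedge (w m) (w (Suc m)) *\<^sub>R w l = wedge (w l) (w (Suc m)) *\<^sub>R w m + wedge (w m) (w l) *\<^sub>R w (Suc m)"
      by (rule wedge_expand)
    then have "a \<bullet> (wedge (w m) (w (Suc m)) *\<^sub>R w l) = a \<bullet> (wedge (w l) (w (Suc m)) *\<^sub>R w m + wedge (w m) (w l) *\<^sub>R w (Suc m))"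
      by simp
    then have "wedge (w m) (w (Suc m)) * (a \<bullet> w l) = - wedge (w (Suc m)) (w l) * (a \<bullet> w m) + wedge (w m) (w l) * (a \<bullet> w (Suc m))"
      by (simp add: inner_add_right wedge_def)
    moreover have "0 < - wedge (w (Suc m)) (w l) * (a \<bullet> w m)"
      using w m by (simp add: mult_pos_neg)
    moreover have "0 \<le> wedge (w m) (w l) * (a \<bullet> w (Suc m))" using w m by simp
    moreover have "0 < wedge (w m) (w (Suc m))" using left_turn[of m "Suc m"] two_directions by simp
    ultimately show ?thesis by (smt (verit) mult_nonneg_nonpos)
  qed
  let ?I = "{Suc m..<Suc m + n}"
  obtain \<tau> where t: "\<And>l. 0 \<le> \<tau> l \<and> \<tau> l \<le> 1"
    and x: "x = vertex (Suc m) + (\<Sum>l\<in>?I. \<tau> l *\<^sub>R w l)"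
    using xin unfolding mem_region_iff[of x "Suc m"] by auto
  have zero: "\<tau> l = 0" if "l \<in> ?I - {Suc m}" for l
  proof -
    have nonneg: "0 \<le> \<tau> l * (a \<bullet> w l)" if "l \<in> ?I" for l
      using t[of l] m pos[of l] that by (cases "l = Suc m") auto
    have "vertex (Suc m) \<in> region"
      using side_subset_region[of "Suc m"] by (auto simp: side_def)
    from min[OF this] have "(\<Sum>l\<in>?I. \<tau> l * (a \<bullet> w l)) \<le> 0"
      unfolding x by (simp add: inner_add_right inner_sum_right del: sum.op_ivl_Suc)
    then have "(\<Sum>l\<in>?I. \<tau> l * (a \<bullet> w l)) = 0"
      using sum_nonneg[of ?I "\<lambda>l. \<tau> l * (a \<bullet> w l)"] nonneg by fastforce
    then have "\<tau> l * (a \<bullet> w l) = 0"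
      using sum_nonneg_eq_0_iff[of ?I "\<lambda>l. \<tau> l * (a \<bullet> w l)"] nonneg that by auto
    then show ?thesis using pos[of l] that by auto
  qed
  have "(\<Sum>l\<in>?I. \<tau> l *\<^sub>R w l) = (\<Sum>l\<in>{Suc m}. \<tau> l *\<^sub>R w l)"
    by (rule sum.mono_neutral_right) (use zero two_directions in auto)
  then have "x \<in> side (Suc m)"
    unfolding mem_side_iff using x t by auto
  then show "x \<in> (\<Union>m. side m)" by blast
qed

text \<open>Up to the opposite vertex the path from \<open>i\<close> to \<open>i + k\<close> consists of edges that do not point
  to the right of \<open>w i\<close>; beyond it, the remaining way back to vertex \<open>i\<close> consists of edges that
  do.\<close>

lemma wedge_side_other_vertex_pos:
  assumes "2 \<le> k" "k < 2 * n"
  shows "0 < wedge (w i) (vertex (i + k) - vertex i)"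
proof (cases "k \<le> n")
  case True
  have nonneg: "0 \<le> wedge (w i) (w l)" if "l \<in> {i..<i + k}" for l
    using left_turn[of i l] that True by (cases "l = i") auto
  have "wedge (w i) (w (Suc i)) \<le> (\<Sum>l\<in>{i..<i + k}. wedge (w i) (w l))"
    by (rule member_le_sum) (use assms nonneg in auto)
  moreover have "0 < wedge (w i) (w (Suc i))"
    using left_turn[of i "Suc i"] two_directions by simp
  ultimately show ?thesis
    by (simp add: vertex_add wedge_sum)
next
  case False
  define J where "J = {i + k..<i + 2 * n}"
  have neg: "wedge (w i) (w l) < 0" if "l \<in> J" for l
  proof -
    have "0 < wedge (w i) (w (l - n))"
      using left_turn[of i "l - n"] that False by (auto simp: J_def)
    moreover have "w l = - w (l - n)"
      using antiperiodic[of "l - n"] that False by (simp add: J_def)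
    ultimately show ?thesis by simp
  qed
  have "vertex (i + k + (2 * n - k)) = vertex (i + k) + (\<Sum>l\<in>{i + k..<i + k + (2 * n - k)}. w l)"
    by (rule vertex_add)
  then have "vertex i = vertex (i + k) + (\<Sum>l\<in>J. w l)"
    using assms by (simp add: vertex_periodic J_def)
  then have "wedge (w i) (vertex (i + k) - vertex i) = (\<Sum>l\<in>J. - wedge (w i) (w l))"
    by (simp add: wedge_sum sum_negf)
  also have "\<dots> > 0"
    by (rule sum_pos) (use neg assms in \<open>auto simp: J_def\<close>)
  finally show ?thesis .
qed

definition corners :: "complex list" where
  "corners = map vertex [0..<2 * n]"

lemma length_corners [simp]: "length corners = 2 * n"
  by (simp add: corners_def)

lemma nth_corners: "i < 2 * n \<Longrightarrow> corners ! i = vertex i"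
  by (simp add: corners_def)

lemma nth_corners_Suc: "i < 2 * n \<Longrightarrow> corners ! (Suc i mod (2 * n)) = vertex (Suc i)"
  using two_directions by (simp add: nth_corners vertex_mod)

lemma polygon_edge_corners: "i < 2 * n \<Longrightarrow> polygon_edge corners i = side i"
  by (simp add: polygon_edge_def side_def nth_corners nth_corners_Suc vertex_mod)

lemma side_mod: "side (m mod (2 * n)) = side m"
proof -
  have "vertex (Suc (m mod (2 * n))) = vertex (Suc m)"
    using vertex_mod[of "Suc (m mod (2 * n))"] vertex_mod[of "Suc m"] by (simp add: mod_Suc_eq)
  then show ?thesis by (simp add: side_def vertex_mod)
qed

lemma polygon_boundary_corners: "polygon_boundary corners = frontier region"
proof -
  have "polygon_boundary corners = (\<Union>i<2 * n. side i)"
    unfolding polygon_boundary_def by (simp add: polygon_edge_corners)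
  also have "\<dots> = (\<Union>m. side m)"
    using side_mod two_directions by (fastforce intro: exI[of _ "_ mod (2 * n)"])
  also have "\<dots> = frontier region"
    using side_subset_frontier frontier_subset_sides by blast
  finally show ?thesis .
qed

lemma wedge_side_vertex_pos:
  assumes "j mod (2 * n) \<noteq> i mod (2 * n)" "j mod (2 * n) \<noteq> Suc i mod (2 * n)"
  shows "0 < wedge (w i) (vertex j - vertex i)"
proof -
  \<comment> \<open>The number of steps from vertex \<open>i\<close> forward to vertex \<open>j\<close>; it is neither 0 nor 1.\<close>
  define k where "k = (j + (2 * n - i mod (2 * n))) mod (2 * n)"
  have lt: "k < 2 * n" using two_directions by (simp add: k_def)
  have "(i + k) mod (2 * n) = (i mod (2 * n) + (j + (2 * n - i mod (2 * n)))) mod (2 * n)"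
    by (simp add: k_def mod_simps)
  also have "i mod (2 * n) + (j + (2 * n - i mod (2 * n))) = j + 2 * n"
    using two_directions mod_less_divisor[of "2 * n" i] by linarith
  finally have jk: "(i + k) mod (2 * n) = j mod (2 * n)" by simp
  then have "k \<noteq> 0" "k \<noteq> 1" using assms by (auto intro: ccontr)
  then have "0 < wedge (w i) (vertex (i + k) - vertex i)"
    using lt by (intro wedge_side_other_vertex_pos) auto
  moreover have "vertex (i + k) = vertex j"
    using vertex_mod[of "i + k"] vertex_mod[of j] jk by simp
  ultimately show ?thesis by simp
qed

text \<open>Side \<open>j\<close> lies weakly to the left of side \<open>i\<close>, and only the end points of side \<open>i\<close> are
  vertices on its line. A common point is thus a convex combination of the ends of side \<open>j\<close>
  with zero weight on every vertex off that line.\<close>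

lemma sides_meet_in_vertices:
  assumes ij: "i mod (2 * n) \<noteq> j mod (2 * n)"
  shows "side i \<inter> side j \<subseteq> {vertex i, vertex (Suc i)} \<inter> {vertex j, vertex (Suc j)}"
proof
  fix x assume "x \<in> side i \<inter> side j"
  then have xi: "x \<in> side i" and xj: "x \<in> side j" by auto
  from xi obtain s where s: "x = vertex i + s *\<^sub>R w i"
    unfolding mem_side_iff by blast
  from xj obtain t where t: "0 \<le> t" "t \<le> 1" "x = vertex j + t *\<^sub>R w j"
    unfolding mem_side_iff by blast
  define D where "D k = wedge (w i) (vertex k - vertex i)" for k
  have nonneg: "0 \<le> D k" for k
    unfolding D_def using side_subset_region[of k] by (intro wedge_side_region_nonneg) (auto simp: side_def)
  have "x - vertex i = (1 - t) *\<^sub>R (vertex j - vertex i) + t *\<^sub>R (vertex (Suc j) - vertex i)"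
    by (simp add: t(3) vertex_Suc algebra_simps)
  moreover have "wedge (w i) (x - vertex i) = 0" by (simp add: s)
  ultimately have sum0: "(1 - t) * D j + t * D (Suc j) = 0"
    unfolding D_def by (simp del: wedge_simps(3))
  then have zeros: "(1 - t) * D j = 0" "t * D (Suc j) = 0"
    using nonneg[of j] nonneg[of "Suc j"] t by (auto simp: add_nonneg_eq_0_iff)
  have period: "a mod (2 * n) = b mod (2 * n) \<Longrightarrow> vertex a = vertex b" for a b
    using vertex_mod[of a] vertex_mod[of b] by simp
  have Suc_cong: "Suc a mod (2 * n) = Suc b mod (2 * n) \<longleftrightarrow> a mod (2 * n) = b mod (2 * n)" for a b
    using mod_Suc[of a "2 * n"] mod_Suc[of b "2 * n"] two_directions by (auto split: if_splits)
  show "x \<in> {vertex i, vertex (Suc i)} \<inter> {vertex j, vertex (Suc j)}"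
  proof (cases "j mod (2 * n) = Suc i mod (2 * n)")
    case True
    then have j2: "Suc j mod (2 * n) = Suc (Suc i) mod (2 * n)"
      by (simp only: Suc_cong)
    have "Suc (Suc i) mod (2 * n) \<noteq> i mod (2 * n)"
      using two_directions mod_Suc[of i "2 * n"] mod_Suc[of "Suc i" "2 * n"] by (auto split: if_splits)
    then have "Suc j mod (2 * n) \<noteq> i mod (2 * n)" using j2 by simp
    moreover have "Suc j mod (2 * n) \<noteq> Suc i mod (2 * n)" using Suc_cong ij by metis
    ultimately have "0 < D (Suc j)"
      unfolding D_def by (rule wedge_side_vertex_pos)
    then have "x = vertex j" using zeros t by simp
    then show ?thesis using period[OF True] by simp
  next
    case False
    then have "0 < D j"
      unfolding D_def using ij by (intro wedge_side_vertex_pos) auto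
    then have "t = 1" using zeros by simp
    then have x: "x = vertex (Suc j)" and "D (Suc j) = 0"
      using zeros t by (auto simp: vertex_Suc)
    then have "\<not> 0 < D (Suc j)" by simp
    then have "Suc j mod (2 * n) = i mod (2 * n)"
      unfolding D_def using wedge_side_vertex_pos[of "Suc j" i] Suc_cong ij by metis
    then have "vertex (Suc j) = vertex i" by (rule period)
    then show ?thesis using x by simp
  qed
qed

lemma simple_polygon_corners: "simple_polygon_vertices corners"
  unfolding simple_polygon_vertices_def
proof (intro conjI allI impI)
  show "3 \<le> length corners" using two_directions by simp
  have "vertex i \<noteq> vertex j" if "i < 2 * n" "j < 2 * n" "i \<noteq> j" for i j
  proof
    assume eq: "vertex i = vertex j"
    then have "\<not> 0 < wedge (w i) (vertex j - vertex i)" by simp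
    then have "j mod (2 * n) = Suc i mod (2 * n)"
      using wedge_side_vertex_pos[of j i] that by auto
    then have "vertex j = vertex (Suc i)"
      using vertex_mod[of j] vertex_mod[of "Suc i"] by simp
    then show False using eq direction_nonzero[of i] by (simp add: vertex_Suc)
  qed
  then show "distinct corners"
    by (simp add: distinct_conv_nth nth_corners)
next
  fix i j assume ij: "i < length corners" "j < length corners" "i \<noteq> j"
  then have "side i \<inter> side j = {vertex i, vertex (Suc i)} \<inter> {vertex j, vertex (Suc j)}"
    using sides_meet_in_vertices[of i j] by (auto simp: side_def)
  with ij show "polygon_edge corners i \<inter> polygon_edge corners j =
      {corners ! i, corners ! (Suc i mod length corners)} \<inter>
      {corners ! j, corners ! (Suc j mod length corners)}"
    by (simp add: polygon_edge_corners nth_corners nth_corners_Suc vertex_mod)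
qed

theorem is_polygon_region: "is_polygon region"
  unfolding is_polygon_def
proof (intro exI conjI)
  show "simple_polygon_vertices corners" by (rule simple_polygon_corners)
  have "inside (frontier region) = interior region"
    by (intro inside_frontier_eq_interior compact_imp_bounded compact_region convex_region)
  then show "region = polygon_boundary corners \<union> inside (polygon_boundary corners)"
    using compact_region interior_subset[of region]
    by (auto simp: polygon_boundary_corners frontier_def compact_imp_closed)
qed

end

section \<open>Minkowski sums of segments\<close>

lemma translated_segment: "{v} + closed_segment 0 u = closed_segment v (v + u)"
  using closed_segment_translation[of v 0 u] by (auto simp: set_plus_def)

lemma segment_upper_half_plane:
  obtains r \<theta> b where "0 \<le> r" "0 \<le> \<theta>" "\<theta> < pi"
    "closed_segment 0 v = {b} + closed_segment 0 (r *\<^sub>R cis \<theta>)"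
proof -
  have v: "v = cmod v *\<^sub>R cis (Arg2pi v)"
    using Arg2pi_eq[of v] by (simp add: cis_conv_exp scaleR_conv_of_real mult.commute)
  have range: "0 \<le> Arg2pi v" "Arg2pi v < 2 * pi" by (rule Arg2pi_ge_0, rule Arg2pi_lt_2pi)
  show thesis
  proof (cases "Arg2pi v < pi")
    case True
    then show ?thesis using that[of "cmod v" "Arg2pi v" 0] range v by simp
  next
    case False
    have "cmod v *\<^sub>R cis (Arg2pi v - pi) = - (cmod v *\<^sub>R cis (Arg2pi v))"
      by (simp add: complex_eq_iff sin_diff cos_diff)
    then have "closed_segment 0 v = {v} + closed_segment 0 (cmod v *\<^sub>R cis (Arg2pi v - pi))"
      using v by (simp add: translated_segment closed_segment_commute)
    then show ?thesis using that[of "cmod v" "Arg2pi v - pi" v] range False by auto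
  qed
qed

lemma parallel_segments_add:
  fixes e :: "'a::real_vector"
  assumes "0 \<le> r" "0 \<le> s"
  shows "closed_segment 0 ((r + s) *\<^sub>R e) = closed_segment 0 (r *\<^sub>R e) + closed_segment 0 (s *\<^sub>R e)"
proof -
  have seg: "closed_segment 0 (t *\<^sub>R e) = (\<lambda>x. x *\<^sub>R e) ` {0..t}" if "0 \<le> t" for t
    using closed_segment_linear_image[of "\<lambda>x. x *\<^sub>R e" 0 t] that
    by (simp add: closed_segment_eq_real_ivl linear_scaleR_left)
  have "{0..r + s} = {0..r} + {0..s}"
  proof (intro set_eqI iffI)
    fix x assume "x \<in> {0..r + s}"
    then have "x = min x r + (x - min x r)" "min x r \<in> {0..r}" "x - min x r \<in> {0..s}"
      using assms by auto
    then show "x \<in> {0..r} + {0..s}" by (metis set_plus_intro)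
  qed (auto simp: set_plus_def)
  then have "(\<lambda>x. x *\<^sub>R e) ` {0..r + s} = (\<lambda>x. x *\<^sub>R e) ` {0..r} + (\<lambda>x. x *\<^sub>R e) ` {0..s}"
    by (force simp: set_plus_def image_iff scaleR_add_left)
  then show ?thesis using assms by (simp add: seg)
qed

text \<open>Segments with the same direction are merged into one and segments of length zero are dropped, which
  leaves distinct directions. Reversing the segments that point into the lower half plane
  accounts for the translation by \<open>c\<close>.\<close>

lemma sum_of_segments_normal_form:
  assumes "finite I"
  shows "\<exists>\<Theta> l c. finite \<Theta> \<and> \<Theta> \<subseteq> {0..<pi} \<and> (\<forall>\<theta>\<in>\<Theta>. 0 < l \<theta>) \<and>
    (\<Sum>i\<in>I. closed_segment 0 (v i)) = {c} + (\<Sum>\<theta>\<in>\<Theta>. closed_segment 0 (l \<theta> *\<^sub>R cis \<theta>))"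
  using assms
proof induction
  case empty
  show ?case
    by (intro exI[of _ "{}"] exI[of _ undefined] exI[of _ 0]) simp
next
  case (insert i I)
  then obtain \<Theta> l c where hyp: "finite \<Theta>" "\<Theta> \<subseteq> {0..<pi}" "\<forall>\<theta>\<in>\<Theta>. 0 < l \<theta>"
    and eq: "(\<Sum>i\<in>I. closed_segment 0 (v i)) = {c} + (\<Sum>\<theta>\<in>\<Theta>. closed_segment 0 (l \<theta> *\<^sub>R cis \<theta>))"
    by auto
  obtain r \<theta> b where b: "0 \<le> r" "0 \<le> \<theta>" "\<theta> < pi" "closed_segment 0 (v i) = {b} + closed_segment 0 (r *\<^sub>R cis \<theta>)"
    by (rule segment_upper_half_plane)
  have step: "(\<Sum>i\<in>insert i I. closed_segment 0 (v i)) =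
      {b + c} + (closed_segment 0 (r *\<^sub>R cis \<theta>) + (\<Sum>\<theta>\<in>\<Theta>. closed_segment 0 (l \<theta> *\<^sub>R cis \<theta>)))"
  proof -
    have "{b + c} = {b} + {c}" by (auto simp: set_plus_def)
    then show ?thesis using insert by (simp add: b(4) eq ac_simps)
  qed
  consider "r = 0" | "0 < r" "\<theta> \<in> \<Theta>" | "0 < r" "\<theta> \<notin> \<Theta>" using b by fastforce
  then show ?case
  proof cases
    case 1
    then show ?thesis using hyp step by (intro exI[of _ \<Theta>] exI[of _ l] exI[of _ "b + c"]) simp
  next
    case 2
    have "(\<Sum>\<theta>'\<in>\<Theta> - {\<theta>}. closed_segment 0 ((l(\<theta> := r + l \<theta>)) \<theta>' *\<^sub>R cis \<theta>')) =
        (\<Sum>\<theta>\<in>\<Theta> - {\<theta>}. closed_segment 0 (l \<theta> *\<^sub>R cis \<theta>))"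
      by (rule sum.cong) auto
    then have "(\<Sum>\<theta>'\<in>\<Theta>. closed_segment 0 ((l(\<theta> := r + l \<theta>)) \<theta>' *\<^sub>R cis \<theta>')) =
        closed_segment 0 ((r + l \<theta>) *\<^sub>R cis \<theta>) + (\<Sum>\<theta>\<in>\<Theta> - {\<theta>}. closed_segment 0 (l \<theta> *\<^sub>R cis \<theta>))"
      using sum.remove[OF hyp(1) 2(2), of "\<lambda>\<theta>'. closed_segment 0 ((l(\<theta> := r + l \<theta>)) \<theta>' *\<^sub>R cis \<theta>')"]
      by simp
    also have "closed_segment 0 ((r + l \<theta>) *\<^sub>R cis \<theta>) = closed_segment 0 (r *\<^sub>R cis \<theta>) + closed_segment 0 (l \<theta> *\<^sub>R cis \<theta>)"
      using 2 hyp by (intro parallel_segments_add) auto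
    also have "\<dots> + (\<Sum>\<theta>\<in>\<Theta> - {\<theta>}. closed_segment 0 (l \<theta> *\<^sub>R cis \<theta>)) =
      closed_segment 0 (r *\<^sub>R cis \<theta>) + (\<Sum>\<theta>\<in>\<Theta>. closed_segment 0 (l \<theta> *\<^sub>R cis \<theta>))"
      using sum.remove[OF hyp(1) 2(2), of "\<lambda>\<theta>. closed_segment 0 (l \<theta> *\<^sub>R cis \<theta>)"] by (simp only: add.assoc)
    finally show ?thesis using hyp step 2
      by (intro exI[of _ \<Theta>] exI[of _ "l(\<theta> := r + l \<theta>)"] exI[of _ "b + c"]) (auto intro: add_pos_pos)
  next
    case 3
    have "(\<Sum>\<theta>'\<in>\<Theta>. closed_segment 0 ((l(\<theta> := r)) \<theta>' *\<^sub>R cis \<theta>')) =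
        (\<Sum>\<theta>\<in>\<Theta>. closed_segment 0 (l \<theta> *\<^sub>R cis \<theta>))"
      by (rule sum.cong) (use 3 in auto)
    then have "(\<Sum>\<theta>'\<in>insert \<theta> \<Theta>. closed_segment 0 ((l(\<theta> := r)) \<theta>' *\<^sub>R cis \<theta>')) =
      closed_segment 0 (r *\<^sub>R cis \<theta>) + (\<Sum>\<theta>\<in>\<Theta>. closed_segment 0 (l \<theta> *\<^sub>R cis \<theta>))"
      using 3 hyp by (subst sum.insert) auto
    then show ?thesis using hyp step 3 b
      by (intro exI[of _ "insert \<theta> \<Theta>"] exI[of _ "l(\<theta> := r)"] exI[of _ "b + c"]) auto
  qed
qed

theorem sum_of_segments_is_polygon:
  assumes fin: "finite I" and ij: "i \<in> I" "j \<in> I" "wedge (v i) (v j) \<noteq> 0"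
  shows "is_polygon (\<Sum>i\<in>I. closed_segment 0 (v i))"
proof -
  let ?S = "\<Sum>i\<in>I. closed_segment 0 (v i)"
  obtain \<Theta> l c where hyp: "finite \<Theta>" "\<Theta> \<subseteq> {0..<pi}" "\<And>\<theta>. \<theta> \<in> \<Theta> \<Longrightarrow> 0 < l \<theta>"
    and eq: "?S = {c} + (\<Sum>\<theta>\<in>\<Theta>. closed_segment 0 (l \<theta> *\<^sub>R cis \<theta>))"
    using sum_of_segments_normal_form[OF fin, of v] by blast
  define n where "n = card \<Theta>"
  \<comment> \<open>With fewer than two directions the sum lies on a line, but it contains \<open>0\<close>, \<open>v i\<close>
    and \<open>v j\<close>.\<close>
  have n2: "2 \<le> n"
  proof (rule ccontr)
    assume "\<not> 2 \<le> n"
    then have "n = 0 \<or> n = 1" by auto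
    then obtain e where e: "(\<Sum>\<theta>\<in>\<Theta>. closed_segment 0 (l \<theta> *\<^sub>R cis \<theta>)) = closed_segment 0 e"
    proof
      assume "n = 0"
      then have "\<Theta> = {}" using hyp by (simp add: n_def)
      then show ?thesis using that[of 0] by simp
    next
      assume "n = 1"
      then obtain \<theta> where "\<Theta> = {\<theta>}" by (auto simp: n_def card_1_singleton_iff)
      then show ?thesis using that by simp
    qed
    have line: "\<exists>t. x = c + t *\<^sub>R e" if "x \<in> ?S" for x
      using that unfolding eq e by (auto simp: set_plus_def closed_segment_def)
    have "(\<Sum>i\<in>I. 0) \<in> ?S"
      unfolding set_sum_alt[OF fin] by (intro CollectI exI[of _ "\<lambda>_. 0"]) simp
    then have "\<exists>t. 0 = c + t *\<^sub>R e" by (intro line) simp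
    then obtain t0 where "0 = c + t0 *\<^sub>R e" ..
    then have t0: "c = - (t0 *\<^sub>R e)" by (simp add: eq_neg_iff_add_eq_0)
    have "\<exists>t. v k = t *\<^sub>R e" if "k \<in> I" for k
    proof -
      have "(\<Sum>i\<in>I. if i = k then v k else 0) \<in> ?S"
        unfolding set_sum_alt[OF fin] by (intro CollectI exI[of _ "\<lambda>i. if i = k then v k else 0"]) simp
      then have "v k \<in> ?S" using that fin by simp
      then obtain t where t: "v k = c + t *\<^sub>R e" using line by blast
      then have "v k = (t - t0) *\<^sub>R e" by (simp add: t0 scaleR_diff_left)
      then show ?thesis ..
    qed
    then obtain s t where "v i = s *\<^sub>R e" "v j = t *\<^sub>R e" using ij by meson
    then show False using ij by simp
  qed
  define xs where "xs = sorted_list_of_set \<Theta>"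
  have len: "length xs = n" by (simp add: xs_def n_def)
  have set: "set xs = \<Theta>" using hyp by (simp add: xs_def)
  have less: "xs ! r < xs ! s" if "r < s" "s < n" for r s
    using that hyp strict_sorted_list_of_set[of \<Theta>] len
    by (simp add: xs_def sorted_wrt_iff_nth_less)
  have nth: "xs ! r \<in> \<Theta>" if "r < n" for r using that len set by auto
  \<comment> \<open>The directions in increasing order, continued antiperiodically.\<close>
  define w where "w j = ((-1) ^ (j div n) * l (xs ! (j mod n))) *\<^sub>R cis (xs ! (j mod n))" for j
  have wedge_cis: "wedge (cis a) (cis b) = sin (b - a)" for a b
    by (simp add: wedge_def sin_diff)
  have sin_pos: "0 < sin (xs ! s - xs ! r)" if "r < s" "s < n" for r s
  proof -
    have "xs ! r \<in> {0..<pi}" "xs ! s \<in> {0..<pi}"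
      using nth[of r] nth[of s] that hyp(2) by auto
    then show ?thesis using less[OF that] by (intro sin_gt_zero) auto
  qed
  interpret zonogon n w c
  proof
    show "2 \<le> n" by (rule n2)
    show "w (j + n) = - w j" for j using n2 by (simp add: w_def)
    fix i j assume ij: "i < j" "j < i + n"
    have wedge_w: "wedge (w i) (w j) = (-1) ^ (i div n) * (-1) ^ (j div n) * l (xs ! (i mod n)) * l (xs ! (j mod n)) * sin (xs ! (j mod n) - xs ! (i mod n))"
      by (simp add: w_def wedge_cis mult_ac)
    have sign_square: "(- 1) ^ k * (- 1) ^ k = (1 :: real)" for k :: nat
      by (simp flip: power_mult_distrib)
    have lpos: "0 < l (xs ! (k mod n))" for k using n2 hyp(3) nth by simp
    have "i div n \<le> j div n" using ij by (intro div_le_mono) simp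
    moreover have "j div n \<le> Suc (i div n)"
      using div_le_mono[of j "i + n" n] ij n2 by simp
    \<comment> \<open>Either both indices lie in the same block of length \<open>n\<close>, or \<open>j\<close> lies in the next one
      and the sign change compensates for the smaller angle.\<close>
    ultimately consider "j div n = i div n" | "j div n = Suc (i div n)" by linarith
    then show "0 < wedge (w i) (w j)"
    proof cases
      case 1
      have "j = i div n * n + j mod n"
        using div_mult_mod_eq[of j n] 1 by metis
      then have "i mod n < j mod n"
        using ij(1) div_mult_mod_eq[of i n] by linarith
      then show ?thesis
        unfolding wedge_w 1 using lpos sin_pos n2 by (simp add: sign_square)
    next
      case 2
      have "j = n + i div n * n + j mod n"
        using div_mult_mod_eq[of j n] 2 by (metis mult_Suc)
      then have "j mod n < i mod n"
        using ij(2) div_mult_mod_eq[of i n] by linarith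
      then have "0 < sin (xs ! (i mod n) - xs ! (j mod n))"
        using sin_pos n2 by simp
      then have "0 < - sin (xs ! (j mod n) - xs ! (i mod n))"
        by (simp add: sin_diff mult.commute)
      moreover have "wedge (w i) (w j) = l (xs ! (i mod n)) * l (xs ! (j mod n)) * - sin (xs ! (j mod n) - xs ! (i mod n))"
        unfolding wedge_w 2 by (simp add: sign_square)
      ultimately show ?thesis using lpos[of i] lpos[of j] by (metis mult_pos_pos)
    qed
  qed
  have "(\<Sum>\<theta>\<in>\<Theta>. closed_segment 0 (l \<theta> *\<^sub>R cis \<theta>)) = (\<Sum>\<theta>\<leftarrow>xs. closed_segment 0 (l \<theta> *\<^sub>R cis \<theta>))"
    using sum.distinct_set_conv_list[of xs "\<lambda>\<theta>. closed_segment 0 (l \<theta> *\<^sub>R cis \<theta>)"] set by (simp add: xs_def)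
  also have "\<dots> = (\<Sum>k<n. closed_segment 0 (l (xs ! k) *\<^sub>R cis (xs ! k)))"
    by (simp add: sum_list_sum_nth len lessThan_atLeast0)
  also have "\<dots> = (\<Sum>k<n. closed_segment 0 (w k))"
    by (intro sum.cong) (simp_all add: w_def)
  finally have "?S = region" by (simp add: eq region_def)
  then show ?thesis using is_polygon_region by simp
qed

section \<open>Sets of subsums\<close>

text \<open>
  One direction of Kakeya's theorem, by the greedy algorithm: take the term \<open>a n\<close> whenever it does
  not exceed the remainder. The remainder never exceeds the sum of the terms not yet considered:
  this is clear if \<open>a n\<close> is taken, and otherwise the remainder is below \<open>a n\<close>, hence below the
  tail by hypothesis. As the tails tend to zero, so does the remainder.
\<close>

lemma subsums_fill_interval:
  fixes a :: "nat \<Rightarrow> real"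
  assumes sum: "summable a"
    and tail: "\<And>n. a n \<le> (\<Sum>k. a (k + Suc n))"
    and x: "0 \<le> x" "x \<le> suminf a"
  obtains e :: "nat \<Rightarrow> real" where "\<And>n. e n \<in> {0, 1}" "(\<lambda>n. e n * a n) sums x"
proof -
  define r where "r = rec_nat x (\<lambda>n y. if a n \<le> y then y - a n else y)"
  have r0: "r 0 = x" and rS: "r (Suc n) = (if a n \<le> r n then r n - a n else r n)" for n
    by (simp_all add: r_def)
  define e where "e n = (if a n \<le> r n then 1 else 0 :: real)" for n
  define T where "T n = (\<Sum>k. a (k + n))" for n
  have T_Suc: "T n = a n + T (Suc n)" for n
    using suminf_split_head[of "\<lambda>k. a (k + n)"] summable_ignore_initial_segment[OF sum, of n]
    by (simp add: T_def)
  have bounds: "0 \<le> r n \<and> r n \<le> T n" for n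
  proof (induction n)
    case 0
    show ?case using x by (simp add: r0 T_def)
  next
    case (Suc n)
    then show ?case using tail[of n] T_Suc[of n] by (auto simp: rS T_def)
  qed
  have partial: "(\<Sum>k<n. e k * a k) = x - r n" for n
    by (induction n) (auto simp: r0 rS e_def)
  have "T = (\<lambda>n. suminf a - (\<Sum>k<n. a k))"
    using suminf_minus_initial_segment[OF sum] by (auto simp: T_def)
  then have "T \<longlonglongrightarrow> suminf a - suminf a"
    using tendsto_diff[OF tendsto_const summable_LIMSEQ[OF sum], of "suminf a"] by simp
  then have "r \<longlonglongrightarrow> 0"
    using bounds by (intro tendsto_sandwich[of "\<lambda>_. 0" r _ T]) auto
  then have "(\<lambda>n. e n * a n) sums (x - 0)"
    unfolding sums_def partial by (intro tendsto_intros)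
  then show thesis using that[of e] by (simp add: e_def)
qed

text \<open>Padded with zeros, the \<open>p\<close> subseries become series over the same index whose termwise sum is
  \<open>f\<close>.\<close>

lemma sums_residue_classes:
  fixes f :: "nat \<Rightarrow> 'a::real_normed_vector"
  assumes "p > 0" and s: "\<And>r. r < p \<Longrightarrow> (\<lambda>j. f (p * j + r)) sums s r"
  shows "f sums (\<Sum>r<p. s r)"
proof -
  define g where "g r k = (if k mod p = r then f k else 0)" for r k
  have "g r sums s r" if "r < p" for r
  proof -
    have "strict_mono (\<lambda>j. p * j + r)"
      using \<open>p > 0\<close> by (auto simp: strict_mono_def)
    moreover have "g r k = 0" if "k \<notin> range (\<lambda>j. p * j + r)" for k
    proof -
      have "k mod p \<noteq> r"
        using that mult_div_mod_eq[of p k] by (metis rangeI)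
      then show ?thesis by (simp add: g_def)
    qed
    moreover have "(\<lambda>j. g r (p * j + r)) sums s r"
      using s[OF that] that by (simp add: g_def)
    ultimately show ?thesis using sums_mono_reindex[of "\<lambda>j. p * j + r" "g r"] by blast
  qed
  then have "(\<lambda>k. \<Sum>r<p. g r k) sums (\<Sum>r<p. s r)"
    by (intro sums_sum) auto
  moreover have "(\<Sum>r<p. g r k) = f k" for k
    using \<open>p > 0\<close> by (simp add: g_def)
  ultimately show ?thesis by simp
qed

text \<open>The digits \<open>u k\<close> in different residue classes of \<open>k\<close> modulo \<open>p\<close> can be chosen independently, and
  along one class the direction is constant. The tail condition compares a term with the later terms
  of its own class, so that within each class the subsums fill an interval.\<close>

lemma subsums_with_periodic_directions:
  fixes a :: "nat \<Rightarrow> real" and d :: "nat \<Rightarrow> complex"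
  assumes p: "p > 0" and nonneg: "\<And>k. 0 \<le> a k" and sum: "summable a"
    and periodic: "\<And>j r. d (p * j + r) = d r"
    and tail: "\<And>m. a m \<le> (\<Sum>k. a (m + p * Suc k))"
  shows "{x. \<exists>u. (\<forall>k. u k \<in> {0, 1}) \<and> (\<lambda>k. u k * (a k *\<^sub>R d k)) sums x} =
    (\<Sum>r<p. closed_segment 0 ((\<Sum>j. a (p * j + r)) *\<^sub>R d r))" (is "?L = ?R")
proof -
  define M where "M r = (\<Sum>j. a (p * j + r))" for r
  have sub: "summable (\<lambda>j. a (p * j + r))" for r
    using summable_reindex[OF sum, of "\<lambda>j. p * j + r"] p nonneg by (simp add: o_def inj_on_def)
  show ?thesis
  proof (intro set_eqI iffI)
    fix x assume "x \<in> ?L"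
    then obtain u where u: "\<And>k. u k \<in> {0, 1}" and x: "(\<lambda>k. u k * (a k *\<^sub>R d k)) sums x"
      by auto
    define e where "e k = Re (u k)" for k
    have e: "u k = of_real (e k)" "0 \<le> e k" "e k \<le> 1" for k
      using u[of k] by (auto simp: e_def)
    have bound: "0 \<le> e k * a k" "e k * a k \<le> a k" for k
      using e[of k] nonneg[of k] by (auto intro: mult_left_le_one_le)
    define b where "b r = (\<Sum>j. e (p * j + r) * a (p * j + r))" for r
    have esum: "summable (\<lambda>j. e (p * j + r) * a (p * j + r))" for r
      using bound by (intro summable_comparison_test'[OF sub[of r]]) simp
    have b: "0 \<le> b r" "b r \<le> M r" for r
      unfolding b_def M_def using bound by (auto intro!: suminf_nonneg suminf_le esum sub)
    have "(\<lambda>j. u (p * j + r) * (a (p * j + r) *\<^sub>R d (p * j + r))) sums (b r *\<^sub>R d r)" for r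
      using sums_scaleR_left[OF summable_sums[OF esum[of r]], of "d r"]
      by (simp add: b_def e(1) periodic scaleR_conv_of_real mult.assoc)
    then have "(\<lambda>k. u k * (a k *\<^sub>R d k)) sums (\<Sum>r<p. b r *\<^sub>R d r)"
      using p by (intro sums_residue_classes)
    then have "x = (\<Sum>r<p. b r *\<^sub>R d r)" using x sums_unique2 by blast
    moreover have "b r *\<^sub>R d r \<in> closed_segment 0 (M r *\<^sub>R d r)" for r
    proof (cases "M r = 0")
      case True
      then show ?thesis using b[of r] by simp
    next
      case False
      then have "b r *\<^sub>R d r = (b r / M r) *\<^sub>R (M r *\<^sub>R d r)" by simp
      moreover have "0 \<le> b r / M r" "b r / M r \<le> 1" using b[of r] False by (auto simp: divide_le_eq)
      ultimately show ?thesis unfolding closed_segment_def by force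
    qed
    ultimately show "x \<in> ?R"
      by (auto simp: set_sum_alt M_def)
  next
    fix x assume "x \<in> ?R"
    then obtain s where x: "x = (\<Sum>r<p. s r)"
      and s: "\<And>r. r < p \<Longrightarrow> s r \<in> closed_segment 0 (M r *\<^sub>R d r)"
      by (auto simp: set_sum_alt M_def)
    have "\<exists>e. (\<forall>j. e j \<in> {0, 1 :: real}) \<and> (\<lambda>j. (e j * a (p * j + r)) *\<^sub>R d r) sums s r" if r: "r < p" for r
    proof -
      obtain t where t: "0 \<le> t" "t \<le> 1" "s r = (t * M r) *\<^sub>R d r"
        using s[OF r] by (auto simp: closed_segment_def)
      have "0 \<le> M r" unfolding M_def by (intro suminf_nonneg sub nonneg)
      then have tM: "0 \<le> t * M r" "t * M r \<le> (\<Sum>j. a (p * j + r))"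
        using t by (auto simp: M_def[symmetric] intro: mult_left_le_one_le)
      have "a (p * n + r) \<le> (\<Sum>k. a (p * (k + Suc n) + r))" for n
        using tail[of "p * n + r"] by (simp add: algebra_simps)
      then obtain e :: "nat \<Rightarrow> real" where "\<And>j. e j \<in> {0, 1}" "(\<lambda>j. e j * a (p * j + r)) sums (t * M r)"
        using subsums_fill_interval[OF sub[of r] _ tM] by blast
      then show ?thesis using t(3) sums_scaleR_left[of _ "t * M r" "d r"] by auto
    qed
    then obtain e where e: "\<And>r j. r < p \<Longrightarrow> e r j \<in> {0, 1 :: real}"
      "\<And>r. r < p \<Longrightarrow> (\<lambda>j. (e r j * a (p * j + r)) *\<^sub>R d r) sums s r"
      by metis
    define u where "u k = complex_of_real (e (k mod p) (k div p))" for k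
    have "u k \<in> {0, 1}" for k
      using e(1)[of "k mod p" "k div p"] p by (auto simp: u_def)
    moreover have "(\<lambda>k. u k * (a k *\<^sub>R d k)) sums x"
      unfolding x
    proof (rule sums_residue_classes[OF p])
      fix r assume r: "r < p"
      then have "u (p * j + r) * (a (p * j + r) *\<^sub>R d (p * j + r)) = (e r j * a (p * j + r)) *\<^sub>R d r" for j
        by (simp add: u_def periodic scaleR_conv_of_real mult.assoc)
      then show "(\<lambda>j. u (p * j + r) * (a (p * j + r) *\<^sub>R d (p * j + r))) sums s r"
        using e(2)[OF r] by simp
    qed
    ultimately show "x \<in> ?L" by auto
  qed
qed

section \<open>Fibonacci numbers and the critical modulus\<close>

lemma golden_ratio_gt_1: "1 < golden_ratio"
proof -
  have "sqrt 1 < sqrt 5" by (rule real_sqrt_less_mono) simp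
  then show ?thesis by (simp add: golden_ratio_def)
qed

lemma golden_ratio_square: "golden_ratio ^ 2 = golden_ratio + 1"
  by (simp add: golden_ratio_def power2_eq_square field_simps)

lemma golden_ratio_power: "golden_ratio ^ (n + 2) = golden_ratio ^ (n + 1) + golden_ratio ^ n"
  by (simp only: power_add golden_ratio_square) (simp add: algebra_simps)

lemma fib1_pos: "0 < fib1 n"
  by (simp add: fib1_def fib_neq_0_nat)

lemma fib1_between_powers:
  "real (fib1 n) \<le> golden_ratio ^ n \<and> golden_ratio ^ n \<le> golden_ratio * real (fib1 n)"
proof (induction n rule: fib.induct)
  case (3 n)
  have "fib1 (Suc (Suc n)) = fib1 (Suc n) + fib1 n"
    using fib1_rec(3)[of n] by simp
  moreover have "golden_ratio ^ Suc (Suc n) = golden_ratio ^ Suc n + golden_ratio ^ n"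
    using golden_ratio_power[of n] by simp
  ultimately show ?case using 3 by (simp add: distrib_left del: power_Suc)
qed (use golden_ratio_gt_1 in \<open>auto simp: fib1_def\<close>)

text \<open>Immediate from the addition formula \<open>f\<^bsub>m+n\<^esub> = f\<^sub>m f\<^sub>n + f\<^bsub>m-1\<^esub> f\<^bsub>n-1\<^esub>\<close>,
  where \<open>f\<^bsub>-1\<^esub> = 0\<close>.\<close>

lemma fib1_supermultiplicative: "fib1 m * fib1 n \<le> fib1 (m + n)"
  using fib_add[of m n] by (simp add: fib1_def mult.commute)

lemma summable_fib1:
  assumes "golden_ratio < q"
  shows "summable (\<lambda>k. real (fib1 k) / q ^ k)"
proof (rule summable_comparison_test'[where N = 0])
  show "summable (\<lambda>k. (golden_ratio / q) ^ k)"
    using assms golden_ratio_gt_1 by (intro summable_geometric) auto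
  show "norm (real (fib1 k) / q ^ k) \<le> (golden_ratio / q) ^ k" for k
    using assms golden_ratio_gt_1 fib1_between_powers[of k]
    by (simp add: power_divide divide_right_mono)
qed

lemma summable_fib1_multiples:
  assumes "golden_ratio < q" "p > 0"
  shows "summable (\<lambda>j. real (fib1 (p * j)) / q ^ (p * j))"
  using summable_reindex[OF summable_fib1[OF assms(1)], of "\<lambda>j. p * j"] assms golden_ratio_gt_1
  by (simp add: o_def inj_on_def)

text \<open>
  In the variable \<open>x = Q\<^bsup>-p\<^esup>\<close> the left-hand side is a power series with radius of convergence
  \<open>1 / a\<close>, where \<open>a = \<phi>\<^sup>p\<close>. Since \<open>\<phi>\<^bsup>k-1\<^esup> \<le> f\<^sub>k \<le> \<phi>\<^sup>k\<close>, it lies between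
  \<open>(1 / \<phi>) / (1 - a x)\<close> and \<open>1 / (1 - a x)\<close>, and the value 2 is attained between the points
  where these two bounds equal 2.
\<close>

lemma fib1_multiples_equation_solvable:
  assumes "p > 0"
  obtains Q where "golden_ratio < Q" "(\<lambda>j. real (fib1 (p * j)) / Q ^ (p * j)) sums 2"
proof -
  let ?g = golden_ratio
  define c where "c j = real (fib1 (p * j))" for j
  define G where "G x = (\<Sum>j. c j * x ^ j)" for x
  define a where "a = ?g ^ p"
  have g1: "1 < ?g" by (rule golden_ratio_gt_1)
  have a1: "1 < a" using assms g1 by (simp add: a_def one_less_power)
  have c_le: "c j \<le> a ^ j" and c_ge: "a ^ j / ?g \<le> c j" for j
    using fib1_between_powers[of "p * j"] g1
    by (auto simp: c_def a_def pos_divide_le_eq mult.commute[of _ ?g] simp flip: power_mult)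
  have summ: "summable (\<lambda>j. c j * x ^ j)" if "0 \<le> x" "a * x < 1" for x
  proof (rule summable_comparison_test'[where N = 0])
    show "summable (\<lambda>j. (a * x) ^ j)" using that a1 by (intro summable_geometric) simp
    show "norm (c j * x ^ j) \<le> (a * x) ^ j" for j
      using that c_le[of j] by (simp add: c_def power_mult_distrib mult_right_mono)
  qed
  have geo: "(\<Sum>j. (a * x) ^ j) = 1 / (1 - a * x)" "summable (\<lambda>j. (a * x) ^ j)"
    if "0 \<le> x" "a * x < 1" for x
    using that a1 by (auto intro!: suminf_geometric summable_geometric)
  \<comment> \<open>The upper bound equals 2 at \<open>a x = 1 / 2\<close>, the lower bound at \<open>a x = y\<close>.\<close>
  define y where "y = 1 - 1 / (2 * ?g)"
  have y: "1 / 2 < y" "y < 1" using g1 by (auto simp: y_def field_simps)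
  define x1 where "x1 = 1 / 2 / a"
  define x2 where "x2 = y / a"
  have x1: "0 < x1" "a * x1 = 1 / 2" using a1 by (auto simp: x1_def)
  have x2: "x1 \<le> x2" "a * x2 = y"
    using a1 y divide_right_mono[of "1 / 2" y a] by (auto simp: x1_def x2_def)
  have "G x1 \<le> (\<Sum>j. (a * x1) ^ j)"
    unfolding G_def using x1 c_le summ[of x1] geo[of x1]
    by (intro suminf_le) (auto simp: power_mult_distrib mult_right_mono)
  then have G1: "G x1 \<le> 2" using geo[of x1] x1 by simp
  have "2 = 1 / ?g * (1 / (1 - a * x2))" using x2 g1 by (simp add: y_def)
  also have "\<dots> = (\<Sum>j. 1 / ?g * (a * x2) ^ j)"
    using geo[of x2] x1 x2 y suminf_mult[of "\<lambda>j. (a * x2) ^ j" "1 / ?g"] by simp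
  also have "\<dots> \<le> G x2"
    unfolding G_def
  proof (rule suminf_le)
    show "1 / ?g * (a * x2) ^ j \<le> c j * x2 ^ j" for j
      using mult_right_mono[OF c_ge[of j], of "x2 ^ j"] x1(1) x2(1) by (simp add: power_mult_distrib)
    show "summable (\<lambda>j. 1 / ?g * (a * x2) ^ j)"
      using geo(2)[of x2] x1 x2 y by (intro summable_mult) auto
    show "summable (\<lambda>j. c j * x2 ^ j)" using x1 x2 y by (intro summ) auto
  qed
  finally have G2: "2 \<le> G x2" .
  \<comment> \<open>A point of convergence beyond \<open>x2\<close>, for continuity up to \<open>x2\<close>.\<close>
  define K where "K = (1 + y) / 2 / a"
  have K: "x2 < K" "a * K < 1"
    using a1 y divide_strict_right_mono[of y "(1 + y) / 2" a] by (auto simp: K_def x2_def)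
  have cont: "isCont G x" if "x1 \<le> x" "x \<le> x2" for x
    unfolding G_def using that x1 K by (intro isCont_powser[where K = K] summ) auto
  obtain x where x: "x1 \<le> x" "x \<le> x2" "G x = 2"
    using IVT[of G x1 2 x2] G1 G2 x2(1) cont by auto
  define Q where "Q = root p (1 / x)"
  have "0 < x" using x x1 by simp
  have Qp: "Q ^ p = 1 / x" using assms \<open>0 < x\<close> by (simp add: Q_def)
  have ax: "a * x < 1"
    using mult_left_mono[OF x(2), of a] a1 x2(2) y by simp
  have "?g ^ p < Q ^ p" using ax \<open>0 < x\<close> by (simp add: Qp a_def[symmetric] field_simps)
  moreover have "0 \<le> Q" using \<open>0 < x\<close> by (simp add: Q_def real_root_ge_zero)
  ultimately have "?g < Q" by (rule power_less_imp_less_base)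
  moreover have "(\<lambda>j. c j * x ^ j) sums 2"
    using summable_sums[OF summ[of x]] \<open>0 < x\<close> ax x(3) by (simp add: G_def)
  then have "(\<lambda>j. real (fib1 (p * j)) / Q ^ (p * j)) sums 2"
    by (simp add: c_def power_mult Qp power_one_over)
  ultimately show thesis by (rule that)
qed

text \<open>The series decreases strictly in \<open>q > \<phi>\<close>. A solution \<open>Q > \<phi>\<close> is therefore the greatest
  one among all reals, hence equal to \<^term>\<open>q_crit p\<close>, and smaller \<open>q\<close> give larger sums.\<close>

lemma fib1_multiples_series_ge_2:
  assumes "golden_ratio < q" "q \<le> q_crit p" "p > 0"
  shows "2 \<le> (\<Sum>j. real (fib1 (p * j)) / q ^ (p * j))"
proof -
  let ?F = "\<lambda>q j. real (fib1 (p * j)) / q ^ (p * j)"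
  have mono: "?F q' j \<le> ?F q j" if "golden_ratio < q" "q \<le> q'" for q q' j
    using that golden_ratio_gt_1 by (intro divide_left_mono power_mono mult_pos_pos) auto
  obtain Q where Q: "golden_ratio < Q" "?F Q sums 2"
    using fib1_multiples_equation_solvable[OF assms(3)] .
  have "q_crit p = Q"
    unfolding q_crit_def
  proof (rule Greatest_equality)
    show "?F Q sums 2" by (rule Q)
    fix q' assume q': "?F q' sums 2"
    show "q' \<le> Q"
    proof (rule ccontr)
      assume "\<not> q' \<le> Q"
      then have "Q < q'" by simp
      have diff: "(\<lambda>j. ?F Q j - ?F q' j) sums 0"
        using sums_diff[OF Q(2) q'] by simp
      have "0 < ?F Q 1 - ?F q' 1"
        using \<open>Q < q'\<close> Q(1) golden_ratio_gt_1 assms(3) fib1_pos[of p]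
        by (simp add: divide_strict_left_mono power_strict_mono)
      then have "0 < (\<Sum>j. ?F Q j - ?F q' j)"
        using mono[OF Q(1), of q'] \<open>Q < q'\<close> sums_summable[OF diff] by (intro suminf_pos2[where i = 1]) auto
      then show False using sums_unique[OF diff] by simp
    qed
  qed
  then have "q \<le> Q" using assms by simp
  have "2 = (\<Sum>j. ?F Q j)" using sums_unique[OF Q(2)] .
  also have "\<dots> \<le> (\<Sum>j. ?F q j)"
    using mono[OF assms(1) \<open>q \<le> Q\<close>] by (intro suminf_le summable_fib1_multiples assms Q)
  finally show ?thesis .
qed

text \<open>Without its first term 1 the series for \<open>q(p)\<close> still sums to at least 1, and multiplied by
  \<open>f\<^sub>m / q\<^sup>m\<close> it is dominated termwise by the tail, by supermultiplicativity.\<close>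

lemma fib1_term_le_tail:
  assumes q: "golden_ratio < q" "q \<le> q_crit p" and p: "p > 0"
  shows "real (fib1 m) / q ^ m \<le> (\<Sum>k. real (fib1 (m + p * Suc k)) / q ^ (m + p * Suc k))"
proof -
  let ?F = "\<lambda>j. real (fib1 (p * j)) / q ^ (p * j)"
  let ?a = "real (fib1 m) / q ^ m"
  have "0 < q" using q golden_ratio_gt_1 by simp
  have F: "summable ?F" by (rule summable_fib1_multiples[OF q(1) p])
  then have F': "summable (\<lambda>k. ?F (Suc k))" by (subst summable_Suc_iff)
  have "1 \<le> (\<Sum>k. ?F (Suc k))"
    using fib1_multiples_series_ge_2[OF q p] suminf_split_head[OF F] by (simp add: fib1_def)
  then have "?a \<le> ?a * (\<Sum>k. ?F (Suc k))"
    using \<open>0 < q\<close> mult_left_mono[of 1 "\<Sum>k. ?F (Suc k)" ?a] by simp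
  also have "\<dots> = (\<Sum>k. ?a * ?F (Suc k))" by (rule suminf_mult[OF F', symmetric])
  also have "\<dots> \<le> (\<Sum>k. real (fib1 (m + p * Suc k)) / q ^ (m + p * Suc k))"
  proof (rule suminf_le)
    show "?a * ?F (Suc k) \<le> real (fib1 (m + p * Suc k)) / q ^ (m + p * Suc k)" for k
    proof -
      have "real (fib1 m) * real (fib1 (p * Suc k)) \<le> real (fib1 (m + p * Suc k))"
        using fib1_supermultiplicative[of m "p * Suc k"] by (simp flip: of_nat_mult)
      then show ?thesis using \<open>0 < q\<close>
        by (simp add: power_add divide_right_mono del: mult_Suc_right)
    qed
    show "summable (\<lambda>k. ?a * ?F (Suc k))" using F' by (rule summable_mult)
    show "summable (\<lambda>k. real (fib1 (m + p * Suc k)) / q ^ (m + p * Suc k))"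
      using summable_reindex[OF summable_fib1[OF q(1)], of "\<lambda>k. m + p * Suc k"] p \<open>0 < q\<close>
      by (simp add: o_def inj_on_def)
  qed
  finally show ?thesis .
qed

section \<open>The set of all expansions is a polygon\<close>

theorem theorem18:
  fixes z :: complex and q \<omega> :: real and d p :: nat
  assumes "d > 0" and "p > 0" and "q > 0"
    and "\<omega> = real d / real p * (2 * pi)"
    and "0 < \<omega>" and "\<omega> < pi"
    and "z = complex_of_real q * exp (\<i> * complex_of_real \<omega>)"
    and "golden_ratio < cmod z" and "cmod z \<le> q_crit p"
  shows "is_polygon (R_inf z) \<and> 0 \<in> R_inf z"
proof
  have z: "z = q *\<^sub>R cis \<omega>"
    using assms(7) by (simp add: cis_conv_exp scaleR_conv_of_real)
  have q: "golden_ratio < q" "q \<le> q_crit p"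
    using assms(3,8,9) by (simp_all add: z)
  define a where "a k = real (fib1 k) / q ^ k" for k
  define e where "e k = cis (- (real k * \<omega>))" for k
  have a_pos: "0 < a k" for k
    using \<open>q > 0\<close> fib1_pos by (simp add: a_def)
  have a_sum: "summable a"
    using summable_fib1[OF q(1)] by (simp add: a_def[abs_def])
  have term_eq: "of_nat (fib1 k) / z ^ k = a k *\<^sub>R e k" for k
  proof -
    have "z ^ k = q ^ k *\<^sub>R cis (real k * \<omega>)"
      by (simp add: z scaleR_power flip: Complex.DeMoivre)
    then show ?thesis
      by (simp add: a_def e_def scaleR_conv_of_real divide_complex_def flip: cis_inverse)
  qed
  have e_periodic: "e (p * j + r) = e r" for j r
  proof -
    have "- (real (p * j + r) * \<omega>) = 2 * pi * (- real (d * j)) + - (real r * \<omega>)"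
      using \<open>p > 0\<close> by (simp add: assms(4) field_simps)
    then have "e (p * j + r) = cis (2 * pi * (- real (d * j))) * e r"
      unfolding e_def by (simp only: cis_mult)
    also have "cis (2 * pi * (- real (d * j))) = 1"
      by (rule cis_multiple_2pi) simp
    finally show ?thesis by simp
  qed
  define M where "M r = (\<Sum>j. a (p * j + r))" for r
  have "R_inf z = (\<Sum>r<p. closed_segment 0 (M r *\<^sub>R e r))"
    unfolding R_inf_def term_eq M_def
    using subsums_with_periodic_directions[OF \<open>p > 0\<close> less_imp_le[OF a_pos] a_sum e_periodic]
      fib1_term_le_tail[OF q \<open>p > 0\<close>] by (simp add: a_def del: mult_Suc_right)
  moreover have "is_polygon (\<Sum>r<p. closed_segment 0 (M r *\<^sub>R e r))"
  proof (rule sum_of_segments_is_polygon)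
    have "real d * 2 < real p"
      using \<open>\<omega> < pi\<close> \<open>p > 0\<close> by (simp add: assms(4) field_simps)
    then have "1 < p" using \<open>d > 0\<close> by linarith
    then show "0 \<in> {..<p}" "1 \<in> {..<p}" by auto
    have M_pos: "0 < M r" for r
      unfolding M_def
      using summable_reindex[OF a_sum, of "\<lambda>j. p * j + r"] a_pos \<open>p > 0\<close>
      by (intro suminf_pos) (auto simp: o_def inj_on_def less_imp_le)
    have "wedge (M 0 *\<^sub>R e 0) (M 1 *\<^sub>R e 1) = - (M 0 * M 1 * sin \<omega>)"
      by (simp add: e_def) (simp add: wedge_def)
    moreover have "0 < M 0 * M 1 * sin \<omega>"
      using M_pos assms(5,6) by (simp add: sin_gt_zero)
    ultimately show "wedge (M 0 *\<^sub>R e 0) (M 1 *\<^sub>R e 1) \<noteq> 0" by linarith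
  qed simp
  ultimately show "is_polygon (R_inf z)" by simp
  show "0 \<in> R_inf z"
    unfolding R_inf_def by (intro CollectI exI[of _ "\<lambda>_. 0"]) simp
qed

end
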